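(* Let $1<p<\infty$. Then $\ell_p$ has a bidemocratic non-total (hence, non-quasi-greedy) basis.
   Context: The scalar field $\mathbb{F}$ is $\mathbb{R}$ or $\mathbb{C}$. A basis of a Banach space $\mathbb{X}$ is a norm-bounded sequence $(x_n)_{n=1}^\infty$ with $\overline{\operatorname{span}}(x_n\colon n\in\mathbb{N})=\mathbb{X}$ for which there is a (unique) norm-bounded sequence $(x_n^* )_{n=1}^\infty$ in $\mathbb{X}^*$ with $x_n^*(x_k)=\delta_{n,k}$ (no Schauder property is assumed). With $\varphi(m)=\sup_{|A|\le m}\|\sum_{k\in A}x_k\|$ and $\varphi^*(m)=\sup_{|A|\le m}\|\sum_{k\in A}x_k^*\|$, the basis is bidemocratic if there is a constant $\Delta_b$ with $\varphi(m)\varphi^*(m)\le\Delta_b\,m$ for all $m\in\mathbb{N}$. The basis is total if the map $f\mapsto(x_n^*(f))_{n=1}^\infty$ is one-to-one on $\mathbb{X}$. A finite set $A\subseteq\mathbb{N}$ is a greedy set of $f\in\mathbb{X}$ if $|x_n^*(f)|\ge|x_k^*(f)|$ whenever $n\in A$, $k\notin A$. The basis is quasi-greedy if there is a constant $C$ such that $\|\sum_{n\in A}x_n^*(f)x_n\|\le C\|f\|$ for all $f\in\mathbb{X}$ and all greedy sets $A$ of $f$. *)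

theory Defs
  imports "HOL-Analysis.Analysis" "HOL-Library.Function_Algebras"
begin

section \<open>Bases of Banach spaces\<close>

text \<open>
  The exponent of \<open>\<ell>\<^sub>p\<close> is a real parameter, so \<open>\<ell>\<^sub>p\<close> cannot be a type of class
  \<^class>\<open>banach\<close>. A Banach space is therefore a linear subspace \<open>V\<close> of an ambient vector space,
  complete under a norm \<open>nrm\<close>. Nothing is assumed of \<open>nrm\<close> outside \<open>V\<close>.
\<close>

locale banach_space_on = vector_space scale
  for scale :: "'k::real_normed_field \<Rightarrow> 'v::ab_group_add \<Rightarrow> 'v" (infixr \<open>*s\<close> 75) +
  fixes V :: "'v set" and nrm :: "'v \<Rightarrow> real"
  assumes subspace_V: "subspace V"
    and nrm_nonneg: "f \<in> V \<Longrightarrow> 0 \<le> nrm f"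
    and nrm_eq_0_iff: "f \<in> V \<Longrightarrow> nrm f = 0 \<longleftrightarrow> f = 0"
    and nrm_scale: "f \<in> V \<Longrightarrow> nrm (c *s f) = norm c * nrm f"
    and nrm_triangle: "f \<in> V \<Longrightarrow> g \<in> V \<Longrightarrow> nrm (f + g) \<le> nrm f + nrm g"
    and complete_V:
      "range s \<subseteq> V \<Longrightarrow> (\<And>e. 0 < e \<Longrightarrow> \<exists>N. \<forall>m\<ge>N. \<forall>n\<ge>N. nrm (s m - s n) < e)
        \<Longrightarrow> \<exists>f\<in>V. (\<lambda>n. nrm (s n - f)) \<longlonglongrightarrow> 0"
begin

definition closed_span :: "'v set \<Rightarrow> 'v set" where
  "closed_span S = {f \<in> V. \<forall>e>0. \<exists>g \<in> span S. nrm (f - g) < e}"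

text \<open>
  The dual space. Functionals are normalised to vanish outside \<open>V\<close>, so that a functional on
  \<open>V\<close> is represented by exactly one function.
\<close>

definition dual :: "('v \<Rightarrow> 'k) set" where
  "dual = {u. (\<forall>f\<in>V. \<forall>g\<in>V. u (f + g) = u f + u g) \<and> (\<forall>c. \<forall>f\<in>V. u (c *s f) = c * u f) \<and>
              (\<exists>C. \<forall>f\<in>V. norm (u f) \<le> C * nrm f) \<and> (\<forall>f. f \<notin> V \<longrightarrow> u f = 0)}"

definition dual_nrm :: "('v \<Rightarrow> 'k) \<Rightarrow> real" where
  "dual_nrm u = (SUP f \<in> {f \<in> V. nrm f \<le> 1}. norm (u f))"

text \<open>\<open>xs\<close> is the sequence of coordinate functionals, written \<open>x\<^sub>n\<^sup>*\<close> on paper.\<close>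

definition coord_functionals :: "(nat \<Rightarrow> 'v) \<Rightarrow> (nat \<Rightarrow> 'v \<Rightarrow> 'k) \<Rightarrow> bool" where
  "coord_functionals x xs \<longleftrightarrow> (\<forall>n. xs n \<in> dual) \<and> (\<exists>C. \<forall>n. dual_nrm (xs n) \<le> C) \<and>
     (\<forall>n k. xs n (x k) = (if n = k then 1 else 0))"

definition basis :: "(nat \<Rightarrow> 'v) \<Rightarrow> bool" where
  "basis x \<longleftrightarrow> range x \<subseteq> V \<and> (\<exists>C. \<forall>n. nrm (x n) \<le> C) \<and> closed_span (range x) = V \<and>
     (\<exists>xs. coord_functionals x xs)"

text \<open>Well defined for a basis by \<open>coord_functionals_unique\<close> below.\<close>

definition coord :: "(nat \<Rightarrow> 'v) \<Rightarrow> nat \<Rightarrow> 'v \<Rightarrow> 'k" where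
  "coord x = (THE xs. coord_functionals x xs)"

text \<open>
  For a basis, the numbers in these two suprema are at most \<open>m\<close> times a common bound for the
  norms of the \<open>x k\<close> or the \<open>coord x k\<close>, so the real-valued \<^const>\<open>Sup\<close> is meaningful.
\<close>

definition phi :: "(nat \<Rightarrow> 'v) \<Rightarrow> nat \<Rightarrow> real" where
  "phi x m = (SUP A \<in> {A. finite A \<and> card A \<le> m}. nrm (\<Sum>k\<in>A. x k))"

definition phi_dual :: "(nat \<Rightarrow> 'v) \<Rightarrow> nat \<Rightarrow> real" where
  "phi_dual x m = (SUP A \<in> {A. finite A \<and> card A \<le> m}. dual_nrm (\<lambda>f. \<Sum>k\<in>A. coord x k f))"

definition bidemocratic :: "(nat \<Rightarrow> 'v) \<Rightarrow> bool" where
  "bidemocratic x \<longleftrightarrow> (\<exists>D. \<forall>m. phi x m * phi_dual x m \<le> D * real m)"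

definition total_basis :: "(nat \<Rightarrow> 'v) \<Rightarrow> bool" where
  "total_basis x \<longleftrightarrow> inj_on (\<lambda>f n. coord x n f) V"

definition greedy_set :: "(nat \<Rightarrow> 'v) \<Rightarrow> 'v \<Rightarrow> nat set \<Rightarrow> bool" where
  "greedy_set x f A \<longleftrightarrow> finite A \<and> (\<forall>n\<in>A. \<forall>k. k \<notin> A \<longrightarrow> norm (coord x k f) \<le> norm (coord x n f))"

definition quasi_greedy :: "(nat \<Rightarrow> 'v) \<Rightarrow> bool" where
  "quasi_greedy x \<longleftrightarrow>
     (\<exists>C. \<forall>f\<in>V. \<forall>A. greedy_set x f A \<longrightarrow> nrm (\<Sum>n\<in>A. coord x n f *s x n) \<le> C * nrm f)"

lemma dual_zero: "u \<in> dual \<Longrightarrow> u 0 = 0"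
  using subspace_0[OF subspace_V] unfolding dual_def
  by (metis (mono_tags, lifting) mem_Collect_eq mult_zero_left scale_zero_left)

lemma dual_eqI:
  assumes u: "u \<in> dual" and v: "v \<in> dual" and S: "S \<subseteq> V" "closed_span S = V"
    and eq: "\<And>f. f \<in> S \<Longrightarrow> u f = v f"
  shows "u = v"
proof
  fix f
  define w where "w f = u f - v f" for f
  have w_add: "w (f + g) = w f + w g" if "f \<in> V" "g \<in> V" for f g
    using that u v by (simp add: w_def dual_def)
  have w_scale: "w (c *s f) = c * w f" if "f \<in> V" for f c
    using that u v by (simp add: w_def dual_def algebra_simps)
  have w_span: "f \<in> V \<and> w f = 0" if "f \<in> span S" for f
    using that
  proof (induction rule: span_induct_alt)
    case base
    show ?case using subspace_0[OF subspace_V] dual_zero[OF u] dual_zero[OF v] by (simp add: w_def)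
  next
    case (step c f g)
    have "f \<in> V" "g \<in> V" "c *s f \<in> V"
      using step S(1) subspace_V by (auto intro: subspace_scale)
    moreover from this have "c *s f + g \<in> V" using subspace_V by (auto intro: subspace_add)
    moreover have "w f = 0" using step eq by (simp add: w_def)
    ultimately show ?case using step by (simp add: w_add w_scale)
  qed
  have "\<exists>C. \<forall>f\<in>V. norm (u f) \<le> C * nrm f" "\<exists>C. \<forall>f\<in>V. norm (v f) \<le> C * nrm f"
    using u v by (simp_all add: dual_def)
  then obtain C1 C2 where C: "\<And>f. f \<in> V \<Longrightarrow> norm (u f) \<le> C1 * nrm f"
      "\<And>f. f \<in> V \<Longrightarrow> norm (v f) \<le> C2 * nrm f"
    by metis
  define C where "C = \<bar>C1\<bar> + \<bar>C2\<bar> + 1"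
  have w_bound: "norm (w f) \<le> C * nrm f" if f: "f \<in> V" for f
  proof -
    have "norm (w f) \<le> C1 * nrm f + C2 * nrm f"
      unfolding w_def using C[OF f] norm_triangle_ineq4[of "u f" "v f"] by linarith
    also have "\<dots> \<le> C * nrm f"
      unfolding distrib_right[symmetric] C_def
      by (rule mult_right_mono) (use nrm_nonneg[OF f] in auto)
    finally show ?thesis .
  qed
  have "C > 0" by (simp add: C_def)
  show "u f = v f"
  proof (cases "f \<in> V")
    case True
    have "norm (w f) \<le> e" if "e > 0" for e :: real
    proof -
      have "e / C > 0" using \<open>C > 0\<close> that by simp
      then obtain g where g: "g \<in> span S" "g \<in> V" "nrm (f - g) < e / C"
        using True S(2) w_span unfolding closed_span_def by blast
      have fg: "f - g \<in> V" using subspace_V True g(2) by (rule subspace_diff)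
      have "w f = w (f - g)"
        using w_add[OF fg g(2)] w_span[OF g(1)] by simp
      also have "norm \<dots> \<le> C * nrm (f - g)" by (rule w_bound[OF fg])
      also have "\<dots> \<le> e" using g(3) \<open>C > 0\<close> by (simp add: field_simps)
      finally show ?thesis .
    qed
    then have "norm (w f) \<le> 0" by (rule field_le_epsilon[of _ 0, simplified])
    then show ?thesis by (simp add: w_def)
  next
    case False
    then show ?thesis using u v by (simp add: dual_def)
  qed
qed

lemma coord_functionals_unique:
  assumes "basis x" "coord_functionals x xs" "coord_functionals x ys"
  shows "xs = ys"
proof
  fix n
  show "xs n = ys n"
    using assms by (intro dual_eqI[of _ _ "range x"]) (auto simp: basis_def coord_functionals_def)
qed

lemma coord_eqI:
  assumes "basis x" "coord_functionals x xs"
  shows "coord x = xs"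
  unfolding coord_def using assms coord_functionals_unique by blast

end

section \<open>The space \<open>\<ell>\<^sub>p\<close>\<close>

definition seq_scale :: "'k::real_normed_field \<Rightarrow> (nat \<Rightarrow> 'k) \<Rightarrow> nat \<Rightarrow> 'k" where
  "seq_scale c f = (\<lambda>n. c * f n)"

definition lp :: "real \<Rightarrow> (nat \<Rightarrow> 'k::real_normed_field) set" where
  "lp p = {f. summable (\<lambda>n. norm (f n) powr p)}"

definition lp_norm :: "real \<Rightarrow> (nat \<Rightarrow> 'k::real_normed_field) \<Rightarrow> real" where
  "lp_norm p f = (\<Sum>n. norm (f n) powr p) powr (1 / p)"

lemma powr_convex_nonneg:
  fixes a b t p :: real
  assumes "1 \<le> p" "0 \<le> a" "0 \<le> b" "0 \<le> t" "t \<le> 1"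
  shows "((1 - t) * a + t * b) powr p \<le> (1 - t) * a powr p + t * b powr p"
proof -
  have *: "(s * c) powr p \<le> s * c powr p" if "0 \<le> s" "s \<le> 1" "0 \<le> c" for s c
  proof -
    have "s powr p \<le> s"
      using that assms(1) powr_mono'[of 1 p s] by (cases "s = 0") auto
    then show ?thesis using that by (simp add: powr_mult mult_right_mono)
  qed
  consider "a = 0" | "b = 0" | "a > 0" "b > 0" using assms by linarith
  then show ?thesis
  proof cases
    case 1 then show ?thesis using *[of t b] assms by simp
  next
    case 2 then show ?thesis using *[of "1 - t" a] assms by simp
  next
    case 3
    then show ?thesis
      using convex_onD[OF powr_convex[OF assms(1)], of t a b] assms by simp
  qed
qed

lemma lp_norm_nonneg: "0 \<le> lp_norm p f"
  by (simp add: lp_norm_def)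

lemma lp_norm_powr:
  assumes "1 \<le> p" "f \<in> lp p"
  shows "lp_norm p f powr p = (\<Sum>n. norm (f n) powr p)"
  using assms by (simp add: lp_norm_def lp_def powr_powr suminf_nonneg)

lemma lp_boundedI:
  assumes p: "1 \<le> p" and C: "0 \<le> C" and le: "\<And>N. (\<Sum>n<N. norm (f n) powr p) \<le> C powr p"
  shows "f \<in> lp p" "lp_norm p f \<le> C"
proof -
  have s: "summable (\<lambda>n. norm (f n) powr p)"
    by (rule bounded_imp_summable[where B = "C powr p"])
      (use le[of "Suc _"] in \<open>auto simp: lessThan_Suc_atMost\<close>)
  then show "f \<in> lp p" by (simp add: lp_def)
  have "(\<Sum>n. norm (f n) powr p) \<le> C powr p"
    using s le by (rule suminf_le_const)
  then have "lp_norm p f \<le> (C powr p) powr (1 / p)"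
    unfolding lp_norm_def using p s by (intro powr_mono2) (auto simp: suminf_nonneg)
  then show "lp_norm p f \<le> C" using p C by (simp add: powr_powr)
qed

lemma lp_partial_sum_le:
  assumes "1 \<le> p" "f \<in> lp p"
  shows "(\<Sum>n<N. norm (f n) powr p) \<le> lp_norm p f powr p"
  using assms by (subst lp_norm_powr) (auto simp: lp_def intro!: sum_le_suminf)

lemma norm_le_lp_norm:
  assumes p: "1 \<le> p" and f: "f \<in> lp p"
  shows "norm (f n) \<le> lp_norm p f"
proof -
  have "norm (f n) powr p \<le> (\<Sum>i<Suc n. norm (f i) powr p)"
    by (rule member_le_sum) auto
  also have "\<dots> \<le> lp_norm p f powr p" using assms by (rule lp_partial_sum_le)
  finally show ?thesis
    using p lp_norm_nonneg[of p f] powr_less_mono2[of p "lp_norm p f" "norm (f n)"] by force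
qed

lemma lp_norm_eq_0_iff:
  assumes "1 \<le> p" "f \<in> lp p"
  shows "lp_norm p f = 0 \<longleftrightarrow> f = 0"
proof
  assume "lp_norm p f = 0"
  then show "f = 0" using norm_le_lp_norm[OF assms] by (auto simp: fun_eq_iff)
next
  assume "f = 0"
  then show "lp_norm p f = 0" by (simp add: lp_norm_def)
qed

lemma lp_scale:
  assumes p: "1 \<le> p" and f: "f \<in> lp p"
  shows "seq_scale c f \<in> lp p" "lp_norm p (seq_scale c f) = norm c * lp_norm p f"
proof -
  have eq: "norm (seq_scale c f n) powr p = norm c powr p * norm (f n) powr p" for n
    by (simp add: seq_scale_def norm_mult powr_mult)
  have s: "summable (\<lambda>n. norm (f n) powr p)" using f by (simp add: lp_def)
  then show "seq_scale c f \<in> lp p" by (simp add: lp_def eq summable_mult)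
  show "lp_norm p (seq_scale c f) = norm c * lp_norm p f"
    using p s by (simp add: lp_norm_def eq suminf_mult powr_mult powr_powr suminf_nonneg)
qed

lemma lp_triangle:
  assumes p: "1 \<le> p" and f: "f \<in> lp p" and g: "g \<in> lp p"
  shows "f + g \<in> lp p" "lp_norm p (f + g) \<le> lp_norm p f + lp_norm p g"
proof -
  define a b where "a = lp_norm p f" and "b = lp_norm p g"
  have ab: "0 \<le> a" "0 \<le> b" by (auto simp: a_def b_def lp_norm_nonneg)
  have "f + g \<in> lp p \<and> lp_norm p (f + g) \<le> a + b"
  proof (cases "a = 0 \<or> b = 0")
    case True
    then show ?thesis
      using f g p ab lp_norm_eq_0_iff[OF p f] lp_norm_eq_0_iff[OF p g] by (auto simp: a_def b_def)
  next
    case False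
    then have a: "a > 0" and b: "b > 0" using ab by auto
    define t where "t = b / (a + b)"
    have t: "0 \<le> t" "t \<le> 1" and t': "1 - t = a / (a + b)"
      using a b by (auto simp: t_def field_simps)
    have bnd: "norm ((f + g) n) powr p \<le> (a + b) powr p *
        ((1 - t) * (norm (f n) powr p / a powr p) + t * (norm (g n) powr p / b powr p))" for n
    proof -
      have "norm ((f + g) n) powr p \<le> (norm (f n) + norm (g n)) powr p"
        using p by (intro powr_mono2) (auto intro: norm_triangle_ineq)
      also have "norm (f n) + norm (g n) =
          (a + b) * ((1 - t) * (norm (f n) / a) + t * (norm (g n) / b))"
      proof -
        have "(a + b) * ((1 - t) * (norm (f n) / a)) = norm (f n)"
          using a b by (simp add: t')
        moreover have "(a + b) * (t * (norm (g n) / b)) = norm (g n)"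
          using a b by (simp add: t_def)
        ultimately show ?thesis by (simp only: distrib_left)
      qed
      also have "\<dots> powr p = (a + b) powr p *
          ((1 - t) * (norm (f n) / a) + t * (norm (g n) / b)) powr p"
        by (rule powr_mult)
      also have "\<dots> \<le> (a + b) powr p *
          ((1 - t) * (norm (f n) / a) powr p + t * (norm (g n) / b) powr p)"
        using p t a b by (intro mult_left_mono powr_convex_nonneg) auto
      finally show ?thesis using a b by (simp add: powr_divide)
    qed
    have "(\<Sum>n<N. norm ((f + g) n) powr p) \<le> (a + b) powr p" for N
    proof -
      have "(\<Sum>n<N. norm ((f + g) n) powr p) \<le> (\<Sum>n<N. (a + b) powr p *
          ((1 - t) * (norm (f n) powr p / a powr p) + t * (norm (g n) powr p / b powr p)))"
        by (rule sum_mono) (rule bnd)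
      also have "\<dots> = (a + b) powr p * ((1 - t) * ((\<Sum>n<N. norm (f n) powr p) / a powr p) +
          t * ((\<Sum>n<N. norm (g n) powr p) / b powr p))"
        by (simp only: sum_distrib_left[symmetric] sum.distrib sum_divide_distrib[symmetric])
      also have "\<dots> \<le> (a + b) powr p * ((1 - t) * 1 + t * 1)"
        using t a b lp_partial_sum_le[OF p f, of N] lp_partial_sum_le[OF p g, of N]
        by (intro mult_left_mono add_mono) (auto simp: a_def b_def field_simps)
      finally show ?thesis by simp
    qed
    then show ?thesis using lp_boundedI[OF p, of "a + b" "f + g"] ab by auto
  qed
  then show "f + g \<in> lp p" "lp_norm p (f + g) \<le> lp_norm p f + lp_norm p g"
    by (auto simp: a_def b_def)
qed

lemma vector_space_seq_scale: "vector_space (seq_scale :: 'k::real_normed_field \<Rightarrow> _)"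
  by unfold_locales (auto simp: seq_scale_def fun_eq_iff algebra_simps)

lemma lp_zero: "0 \<in> lp p"
  by (simp add: lp_def)

lemma lp_diff:
  assumes "1 \<le> p" "f \<in> lp p" "g \<in> lp p"
  shows "f - g \<in> lp p"
proof -
  have "f - g = f + seq_scale (- 1) g" by (auto simp: seq_scale_def fun_eq_iff)
  then show ?thesis using assms by (metis lp_scale(1) lp_triangle(1))
qed

lemma lp_complete:
  fixes s :: "nat \<Rightarrow> nat \<Rightarrow> 'k::{real_normed_field, banach}"
  assumes p: "1 \<le> p" and s: "range s \<subseteq> lp p"
    and cauchy: "\<And>e. 0 < e \<Longrightarrow> \<exists>N. \<forall>m\<ge>N. \<forall>n\<ge>N. lp_norm p (s m - s n) < e"
  shows "\<exists>f\<in>lp p. (\<lambda>n. lp_norm p (s n - f)) \<longlonglongrightarrow> 0"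
proof -
  have sV: "s n \<in> lp p" for n using s by auto
  have d: "s m - s n \<in> lp p" for m n using p sV by (intro lp_diff)
  have "Cauchy (\<lambda>m. s m i)" for i
  proof (rule metric_CauchyI)
    fix e :: real assume "0 < e"
    then obtain N where N: "\<And>m n. m \<ge> N \<Longrightarrow> n \<ge> N \<Longrightarrow> lp_norm p (s m - s n) < e"
      using cauchy by blast
    show "\<exists>M. \<forall>m\<ge>M. \<forall>n\<ge>M. dist (s m i) (s n i) < e"
    proof (intro exI allI impI)
      fix m n assume "N \<le> m" "N \<le> n"
      then show "dist (s m i) (s n i) < e"
        using N[of m n] norm_le_lp_norm[OF p d[of m n], of i] by (simp add: dist_norm)
    qed
  qed
  then have "\<exists>l. (\<lambda>m. s m i) \<longlonglongrightarrow> l" for i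
    by (simp add: Cauchy_convergent_iff convergent_def)
  then obtain f where f: "\<And>i. (\<lambda>m. s m i) \<longlonglongrightarrow> f i" by metis
  have key: "\<exists>N. \<forall>n\<ge>N. s n - f \<in> lp p \<and> lp_norm p (s n - f) \<le> e" if e: "0 < e" for e
  proof -
    obtain N where N: "\<And>m n. m \<ge> N \<Longrightarrow> n \<ge> N \<Longrightarrow> lp_norm p (s m - s n) < e"
      using cauchy[OF e] by blast
    have "s n - f \<in> lp p \<and> lp_norm p (s n - f) \<le> e" if n: "n \<ge> N" for n
    proof -
      have "(\<Sum>i<M. norm ((s n - f) i) powr p) \<le> e powr p" for M
      proof (rule tendsto_upperbound)
        show "(\<lambda>m. \<Sum>i<M. norm ((s n - s m) i) powr p) \<longlonglongrightarrow> (\<Sum>i<M. norm ((s n - f) i) powr p)"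
          using p f by (auto intro!: tendsto_sum tendsto_powr' tendsto_norm tendsto_diff tendsto_const)
        show "\<forall>\<^sub>F m in sequentially. (\<Sum>i<M. norm ((s n - s m) i) powr p) \<le> e powr p"
        proof (rule eventually_sequentiallyI)
          fix m assume m: "N \<le> m"
          have "(\<Sum>i<M. norm ((s n - s m) i) powr p) \<le> lp_norm p (s n - s m) powr p"
            by (rule lp_partial_sum_le[OF p d])
          also have "\<dots> \<le> e powr p"
            using N[OF n m] p lp_norm_nonneg by (intro powr_mono2) auto
          finally show "(\<Sum>i<M. norm ((s n - s m) i) powr p) \<le> e powr p" .
        qed
      qed simp
      then show ?thesis using lp_boundedI[OF p, of e "s n - f"] e by auto
    qed
    then show ?thesis by blast
  qed
  obtain N where "s N - f \<in> lp p" using key[of 1] by auto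
  then have "s N - (s N - f) \<in> lp p" by (rule lp_diff[OF p sV])
  moreover have "s N - (s N - f) = f" by (simp add: fun_eq_iff)
  ultimately have fV: "f \<in> lp p" by simp
  have "(\<lambda>n. lp_norm p (s n - f)) \<longlonglongrightarrow> 0"
  proof (rule LIMSEQ_I)
    fix e :: real assume "0 < e"
    then obtain N where N: "\<And>n. N \<le> n \<Longrightarrow> lp_norm p (s n - f) \<le> e / 2"
      using key[of "e / 2"] by auto
    show "\<exists>N. \<forall>n\<ge>N. norm (lp_norm p (s n - f) - 0) < e"
    proof (intro exI allI impI)
      fix n assume "N \<le> n"
      then show "norm (lp_norm p (s n - f) - 0) < e"
        using N[of n] \<open>0 < e\<close> by (simp add: abs_of_nonneg[OF lp_norm_nonneg])
    qed
  qed
  with fV show ?thesis by blast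
qed

lemma banach_space_on_lp:
  assumes p: "1 \<le> p"
  shows "banach_space_on seq_scale (lp p :: (nat \<Rightarrow> 'k::{real_normed_field, banach}) set) (lp_norm p)"
proof -
  interpret vector_space "seq_scale :: 'k \<Rightarrow> _" by (rule vector_space_seq_scale)
  show ?thesis
  proof unfold_locales
    show "subspace (lp p :: (nat \<Rightarrow> 'k) set)"
      unfolding subspace_def using p by (auto intro: lp_zero lp_scale lp_triangle)
  qed (use p in \<open>auto intro: lp_norm_nonneg lp_scale lp_triangle lp_complete
        simp: lp_norm_eq_0_iff\<close>)
qed

end

theory Submission
  imports Defs
begin

text \<open>
  Let \<open>e\<^sub>0, e\<^sub>1, \<dots>\<close> be the unit vectors and put
  \<open>x\<^sub>n = e\<^sub>n\<^sub>+\<^sub>1 + a\<^sub>n e\<^sub>0\<close> with \<open>a\<^sub>n = (n + 1) powr (1/p - 1)\<close>. The coordinate functionals are those of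
  \<open>e\<^sub>1, e\<^sub>2, \<dots>\<close>, so all of them vanish at \<open>e\<^sub>0\<close>. With \<open>q\<close> the conjugate exponent of \<open>p\<close>, the weight \<open>a\<close>
  lies in weak \<open>\<ell>\<^sub>q\<close>, so its sum over a set of size \<open>m\<close> is at most \<open>p m powr (1/p)\<close> and the
  \<open>e\<^sub>0\<close>-components do not affect the order of \<open>\<phi>\<close>. But \<open>a\<close> is not in \<open>\<ell>\<^sub>q\<close>, so no nonzero functional
  vanishes on all \<open>x\<^sub>n\<close>; concretely, with \<open>h\<^sub>N\<close> the harmonic numbers, the vectors
  \<open>\<Sum>n<N. (n + 1) powr (-1/p) / h\<^sub>N x\<^sub>n\<close> converge to \<open>e\<^sub>0\<close>.
\<close>

section \<open>Power inequalities and sums of decreasing weights\<close>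

lemma sum_fun_apply: "(\<Sum>k\<in>A. F k) i = (\<Sum>k\<in>A. F k i)"
  by (induction A rule: infinite_finite_induct) auto

text \<open>The half-line is closed at 0 because the terms fed to Jensen's inequality may
  vanish.\<close>

lemma convex_on_powr_nonneg: "1 \<le> p \<Longrightarrow> convex_on {0..} (\<lambda>x::real. x powr p)"
  by (rule convex_onI) (auto intro: powr_convex_nonneg)

text \<open>Hoelder's inequality against the constant 1. It follows from Jensen's inequality for
  \<open>x powr p\<close> with equal weights \<open>1 / m\<close>.\<close>

lemma sum_le_card_powr:
  fixes u :: "'a \<Rightarrow> real"
  assumes p: "1 \<le> p" and u: "\<And>n. n \<in> A \<Longrightarrow> 0 \<le> u n"
  shows "(\<Sum>n\<in>A. u n) \<le> real (card A) powr (1 - 1 / p) * (\<Sum>n\<in>A. u n powr p) powr (1 / p)"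
proof (cases "finite A \<and> A \<noteq> {}")
  case True
  define m where "m = real (card A)"
  have m: "m > 0" using True by (auto simp: m_def card_gt_0_iff)
  have "(\<Sum>n\<in>A. (1 / m) *\<^sub>R u n) powr p \<le> (\<Sum>n\<in>A. (1 / m) * u n powr p)"
    using True u m by (intro convex_on_sum[OF _ _ convex_on_powr_nonneg[OF p]]) (auto simp: m_def)
  then have le: "((\<Sum>n\<in>A. u n) / m) powr p \<le> (\<Sum>n\<in>A. u n powr p) / m"
    by (simp add: sum_divide_distrib)
  have "(\<Sum>n\<in>A. u n) / m = (((\<Sum>n\<in>A. u n) / m) powr p) powr (1 / p)"
    using p u m by (simp add: powr_powr sum_nonneg)
  also have "\<dots> \<le> ((\<Sum>n\<in>A. u n powr p) / m) powr (1 / p)"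
    using le p by (intro powr_mono2) auto
  finally have "(\<Sum>n\<in>A. u n) \<le> m * ((\<Sum>n\<in>A. u n powr p) / m) powr (1 / p)"
    using m by (simp add: field_simps)
  also have "\<dots> = m powr (1 - 1 / p) * (\<Sum>n\<in>A. u n powr p) powr (1 / p)"
    using m by (simp add: powr_divide powr_diff sum_nonneg)
  finally show ?thesis by (simp add: m_def)
qed auto

text \<open>Mean value theorem for \<open>t powr (1 / p)\<close>, whose derivative decreases. The
  case \<open>m = 0\<close> is separate because the derivative formula is only available for
  positive \<open>t\<close>. The right-hand side telescopes when summed.\<close>

lemma powr_weight_le_diff:
  assumes p: "1 \<le> p"
  shows "real (Suc m) powr (1 / p - 1) \<le> p * (real (Suc m) powr (1 / p) - real m powr (1 / p))"
proof (cases "m = 0")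
  case False
  have der: "((\<lambda>t. t powr (1 / p)) has_real_derivative (1 / p) * t powr (1 / p - 1)) (at t)"
    if "real m \<le> t" for t
    using that False by (auto intro!: derivative_eq_intros)
  obtain z where z: "real m < z" "z < real (Suc m)"
    "real (Suc m) powr (1 / p) - real m powr (1 / p) = (real (Suc m) - real m) * ((1 / p) * z powr (1 / p - 1))"
    using MVT2[of "real m" "real (Suc m)" "\<lambda>t. t powr (1 / p)" "\<lambda>t. (1 / p) * t powr (1 / p - 1)"] der
    by auto
  have "real (Suc m) powr (1 / p - 1) \<le> z powr (1 / p - 1)"
    using z p False by (intro powr_mono2') auto
  then show ?thesis using z(3) p by simp
qed (use p in auto)

text \<open>The weights decrease, so initial segments are the worst sets: the element
  \<open>b\<close> added as new maximum is at least \<open>card A\<close>, hence weighs no more than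
  index \<open>card A\<close> does. The bounds of \<open>powr_weight_le_diff\<close> then
  telescope.\<close>

lemma sum_powr_weight_le:
  assumes p: "1 \<le> p" and A: "finite A"
  shows "(\<Sum>n\<in>A. real (Suc n) powr (1 / p - 1)) \<le> p * real (card A) powr (1 / p)"
  using A
proof (induction A rule: finite_linorder_max_induct)
  case (insert b A)
  have b: "b \<notin> A" using insert by auto
  have "A \<subseteq> {..<b}" using insert by auto
  then have "card A \<le> b" using card_mono[of "{..<b}" A] by simp
  then have "real (Suc b) powr (1 / p - 1) \<le> real (Suc (card A)) powr (1 / p - 1)"
    using p by (intro powr_mono2') auto
  also have "\<dots> \<le> p * (real (Suc (card A)) powr (1 / p) - real (card A) powr (1 / p))"
    by (rule powr_weight_le_diff[OF p])
  finally show ?case using insert.IH insert.hyps b by (simp add: algebra_simps)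
qed auto

section \<open>Finitely supported sequences and tails\<close>

lemma lp_norm_finite_support:
  assumes "finite A" and "\<And>n. n \<notin> A \<Longrightarrow> f n = 0"
  shows "f \<in> lp p" "lp_norm p f = (\<Sum>n\<in>A. norm (f n) powr p) powr (1 / p)"
proof -
  have 0: "norm (f n) powr p = 0" if "n \<notin> A" for n using assms(2)[OF that] by simp
  show "f \<in> lp p" unfolding lp_def using summable_finite[OF assms(1) 0] by simp
  show "lp_norm p f = (\<Sum>n\<in>A. norm (f n) powr p) powr (1 / p)"
    unfolding lp_norm_def using suminf_finite[OF assms(1) 0] by simp
qed

lemma lp_tail:
  assumes p: "1 \<le> p" and f: "f \<in> lp p" and e: "0 < e"
  shows "\<exists>N. lp_norm p (\<lambda>i. if i < N then 0 else f i) \<le> e"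
proof -
  have "summable (\<lambda>i. norm (f i) powr p)" using f by (simp add: lp_def)
  then obtain N where N: "\<And>m n. m \<ge> N \<Longrightarrow> norm (\<Sum>i=m..<n. norm (f i) powr p) < e powr p"
    unfolding summable_Cauchy using e by (metis powr_gt_zero less_irrefl)
  have "(\<Sum>i<K. norm (if i < N then 0 else f i) powr p) \<le> e powr p" for K
  proof -
    have "(\<Sum>i<K. norm (if i < N then 0 else f i) powr p) = (\<Sum>i=N..<K. norm (f i) powr p)"
      by (rule sum.mono_neutral_cong_right) auto
    also have "\<dots> \<le> e powr p" using N[of N K] by simp
    finally show ?thesis .
  qed
  then have "lp_norm p (\<lambda>i. if i < N then 0 else f i) \<le> e"
    using p e by (intro lp_boundedI(2)) auto
  then show ?thesis ..
qed

section \<open>The skewed vectors and their coordinates\<close>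

definition unit_vec :: "nat \<Rightarrow> nat \<Rightarrow> 'k::real_normed_field" where
  "unit_vec j = (\<lambda>i. if i = j then 1 else 0)"

definition skew_vec :: "real \<Rightarrow> nat \<Rightarrow> nat \<Rightarrow> 'k::real_normed_field" where
  "skew_vec p n = unit_vec (Suc n) + seq_scale (of_real (real (Suc n) powr (1 / p - 1))) (unit_vec 0)"

text \<open>The value 0 outside \<open>lp p\<close> is the normalisation demanded by
  \<open>dual\<close>.\<close>

definition shift_coord :: "real \<Rightarrow> nat \<Rightarrow> (nat \<Rightarrow> 'k::real_normed_field) \<Rightarrow> 'k" where
  "shift_coord p n f = (if f \<in> lp p then f (Suc n) else 0)"

definition skew_approx :: "real \<Rightarrow> nat \<Rightarrow> nat \<Rightarrow> 'k::real_normed_field" where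
  "skew_approx p N = (\<Sum>n<N. seq_scale (of_real (real (Suc n) powr (- 1 / p) / harm N)) (skew_vec p n))"

lemma unit_vec_lp:
  fixes j :: nat and u :: "nat \<Rightarrow> 'k::real_normed_field"
  defines "u \<equiv> unit_vec j"
  shows "u \<in> lp p" "lp_norm p u = 1"
  using lp_norm_finite_support[of "{j}" u p] by (auto simp: u_def unit_vec_def)

lemma skew_vec_lp: "1 \<le> p \<Longrightarrow> skew_vec p n \<in> lp p"
  unfolding skew_vec_def by (intro lp_triangle lp_scale unit_vec_lp)

lemma skew_vec_apply:
  "skew_vec p n i = (case i of
      0 \<Rightarrow> of_real (real (Suc n) powr (1 / p - 1)) | Suc k \<Rightarrow> if n = k then 1 else 0)"
  by (simp add: skew_vec_def unit_vec_def seq_scale_def split: nat.split)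

lemma sum_skew_vec:
  assumes "finite A"
  shows "(\<Sum>n\<in>A. seq_scale (c n) (skew_vec p n)) = (\<lambda>i. case i of
      0 \<Rightarrow> (\<Sum>n\<in>A. c n * of_real (real (Suc n) powr (1 / p - 1)))
    | Suc k \<Rightarrow> if k \<in> A then c k else 0)"
  using assms
  by (auto simp: fun_eq_iff sum_fun_apply seq_scale_def skew_vec_apply if_distrib[of "(*) _"]
      cong: if_cong split: nat.split)

section \<open>Approximation of the zeroth unit vector\<close>

text \<open>The exponents \<open>- 1 / p\<close> and \<open>1 / p - 1\<close> add to -1, so entry 0
  of \<open>skew_approx p N\<close> is \<open>harm N / harm N\<close>. This is 1 for positive
  \<open>N\<close> and cancels against \<open>unit_vec 0\<close>.\<close>

lemma skew_approx_eq:
  assumes "0 < N"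
  shows "skew_approx p N - unit_vec 0 = (\<lambda>i. case i of 0 \<Rightarrow> 0
    | Suc k \<Rightarrow> if k < N then of_real (real (Suc k) powr (- 1 / p) / harm N) else 0)"
proof -
  have sum_eq: "(\<Sum>n<N. of_real (real (Suc n) powr (- 1 / p) / harm N) * of_real (real (Suc n) powr (1 / p - 1)))
      = (of_real (\<Sum>n<N. inverse (real (Suc n)) / harm N) :: 'a)"
    unfolding of_real_sum of_real_mult[symmetric]
    by (intro sum.cong refl arg_cong[of _ _ of_real])
      (simp add: powr_diff powr_minus_divide inverse_eq_divide del: of_nat_Suc)
  have "harm N \<noteq> (0::real)" using harm_pos[OF assms, where 'a = real] by linarith
  then have "(\<Sum>n<N. inverse (real (Suc n)) / harm N) = 1"
    by (simp add: sum_divide_distrib[symmetric] harm_altdef[symmetric] del: of_nat_Suc)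
  then show ?thesis
    unfolding skew_approx_def sum_skew_vec[OF finite_lessThan] sum_eq
    by (auto simp: fun_eq_iff unit_vec_def split: nat.split)
qed

lemma skew_approx_lp: "1 \<le> p \<Longrightarrow> skew_approx p N - unit_vec 0 \<in> lp p"
  unfolding skew_approx_def sum_skew_vec[OF finite_lessThan]
  by (rule lp_norm_finite_support(1)[of "{..N}"]) (auto simp: unit_vec_def split: nat.split)

text \<open>The p-th powers of the nonzero entries are reciprocals of 1 to \<open>N\<close> divided
  by \<open>harm N powr p\<close>, so they sum to \<open>harm N powr (1 - p)\<close>.\<close>

lemma skew_approx_norm:
  assumes p: "1 \<le> p" and N: "0 < N"
  shows "lp_norm p (skew_approx p N - unit_vec 0 :: nat \<Rightarrow> 'k::real_normed_field) = harm N powr (1 / p - 1)"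
proof -
  let ?w = "skew_approx p N - unit_vec 0 :: nat \<Rightarrow> 'k"
  have h: "harm N > (0::real)" using N by simp
  have "lp_norm p ?w = (\<Sum>n\<in>Suc ` {..<N}. norm (?w n) powr p) powr (1 / p)"
    by (rule lp_norm_finite_support(2)) (auto simp: skew_approx_eq[OF N] split: nat.split)
  also have "(\<Sum>n\<in>Suc ` {..<N}. norm (?w n) powr p) = (\<Sum>n<N. inverse (real (Suc n)) / harm N powr p)"
    using p h unfolding skew_approx_eq[OF N]
    by (subst sum.reindex) (auto simp: norm_divide norm_mult powr_mult powr_divide powr_powr
        powr_minus_divide inverse_eq_divide simp del: of_nat_Suc intro!: sum.cong)
  also have "\<dots> = harm N / harm N powr p"
    by (simp add: sum_divide_distrib[symmetric] harm_altdef[symmetric] del: of_nat_Suc)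
  also have "\<dots> powr (1 / p) = harm N powr (1 / p - 1)"
    using h p by (simp add: powr_divide powr_powr powr_diff)
  finally show ?thesis .
qed

text \<open>The harmonic numbers diverge and, as \<open>1 < p\<close>, the exponent
  \<open>1 / p - 1\<close> is negative.\<close>

lemma skew_approx_tendsto:
  assumes p: "1 < p"
  shows "(\<lambda>N. lp_norm p (skew_approx p N - unit_vec 0 :: nat \<Rightarrow> 'k::real_normed_field)) \<longlonglongrightarrow> 0"
proof (rule Lim_transform_eventually)
  show "(\<lambda>N. harm N powr (1 / p - 1)) \<longlonglongrightarrow> (0::real)"
    using p by (intro tendsto_neg_powr harm_at_top) (auto simp: field_simps)
  show "\<forall>\<^sub>F N in sequentially. harm N powr (1 / p - 1)
      = lp_norm p (skew_approx p N - unit_vec 0 :: nat \<Rightarrow> 'k)"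
    using eventually_gt_at_top[of 0] by eventually_elim (use p in \<open>simp add: skew_approx_norm\<close>)
qed

section \<open>Norms of sums of vectors and of functionals\<close>

lemma norm_sum_skew_vec_le:
  assumes p: "1 \<le> p" and A: "finite A"
  shows "lp_norm p (\<Sum>n\<in>A. skew_vec p n :: nat \<Rightarrow> 'k::real_normed_field) \<le> (p + 1) * real (card A) powr (1 / p)"
proof -
  define v :: "nat \<Rightarrow> 'k" where "v i = (if i \<in> Suc ` A then 1 else 0)" for i
  define s where "s = (\<Sum>n\<in>A. real (Suc n) powr (1 / p - 1))"
  have "(\<Sum>n\<in>A. skew_vec p n) = (\<Sum>n\<in>A. seq_scale 1 (skew_vec p n :: nat \<Rightarrow> 'k))"
    by (simp add: seq_scale_def)
  also have "\<dots> = v + seq_scale (of_real s) (unit_vec 0)"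
    unfolding sum_skew_vec[OF A] v_def s_def
    by (auto simp: fun_eq_iff seq_scale_def unit_vec_def split: nat.split)
  finally have eq: "(\<Sum>n\<in>A. skew_vec p n) = v + seq_scale (of_real s) (unit_vec 0)" .
  have v: "v \<in> lp p" and "lp_norm p v = (\<Sum>n\<in>Suc ` A. norm (v n) powr p) powr (1 / p)"
    using A lp_norm_finite_support[of "Suc ` A" v p] by (auto simp: v_def)
  then have nv: "lp_norm p v = real (card A) powr (1 / p)"
    by (simp add: v_def card_image)
  have "s \<ge> 0" by (auto simp: s_def intro: sum_nonneg)
  have "lp_norm p (\<Sum>n\<in>A. skew_vec p n :: nat \<Rightarrow> 'k) \<le> lp_norm p v + lp_norm p (seq_scale (of_real s) (unit_vec 0 :: nat \<Rightarrow> 'k))"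
    unfolding eq using p v by (intro lp_triangle lp_scale unit_vec_lp)
  also have "\<dots> = real (card A) powr (1 / p) + s"
    using p \<open>s \<ge> 0\<close> by (simp add: nv lp_scale unit_vec_lp)
  also have "\<dots> \<le> (p + 1) * real (card A) powr (1 / p)"
    using sum_powr_weight_le[OF p A] by (simp add: s_def algebra_simps)
  finally show ?thesis .
qed

text \<open>Hoelder's inequality; \<open>1 - 1 / p\<close> is the reciprocal of the conjugate
  exponent.\<close>

lemma norm_sum_shift_coord_le:
  assumes p: "1 \<le> p" and A: "finite A" and f: "f \<in> lp p"
  shows "norm (\<Sum>n\<in>A. shift_coord p n f) \<le> real (card A) powr (1 - 1 / p) * lp_norm p f"
proof -
  have "norm (\<Sum>n\<in>A. shift_coord p n f) \<le> (\<Sum>n\<in>A. norm (f (Suc n)))"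
    using f by (simp add: shift_coord_def norm_sum)
  also have "\<dots> \<le> real (card A) powr (1 - 1 / p) * (\<Sum>n\<in>A. norm (f (Suc n)) powr p) powr (1 / p)"
    using p by (rule sum_le_card_powr) simp
  also have "\<dots> \<le> real (card A) powr (1 - 1 / p) * lp_norm p f"
  proof (rule mult_left_mono)
    have "(\<Sum>n\<in>A. norm (f (Suc n)) powr p) = (\<Sum>i\<in>Suc ` A. norm (f i) powr p)"
      by (simp add: sum.reindex)
    also have "\<dots> \<le> (\<Sum>i. norm (f i) powr p)"
      using A f by (intro sum_le_suminf) (auto simp: lp_def)
    finally show "(\<Sum>n\<in>A. norm (f (Suc n)) powr p) powr (1 / p) \<le> lp_norm p f"
      unfolding lp_norm_def using p by (intro powr_mono2) (auto intro: sum_nonneg)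
  qed simp
  finally show ?thesis .
qed

section \<open>Density of the span\<close>

text \<open>After the tail of \<open>f\<close> is cut off, a combination of the vectors matches
  every remaining entry except entry 0. The error there is a multiple of \<open>unit_vec 0\<close>,
  which \<open>skew_approx\<close> approximates within the span.\<close>

lemma skew_vec_span_dense:
  fixes f :: "nat \<Rightarrow> 'k::{real_normed_field, banach}"
  assumes p: "1 < p" and f: "f \<in> lp p" and e: "0 < e"
  shows "\<exists>g\<in>module.span seq_scale (range (skew_vec p)). lp_norm p (f - g) < e"
proof -
  interpret vector_space "seq_scale :: 'k \<Rightarrow> _" by (rule vector_space_seq_scale)
  have p1: "1 \<le> p" using p by simp
  obtain M where M: "lp_norm p (\<lambda>i. if i < M then 0 else f i) \<le> e / 2"
    using lp_tail[OF p1 f, of "e / 2"] e by auto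
  \<comment> \<open>The \<open>M - 1\<close> vectors reproduce entries 1 to \<open>M - 1\<close> of
    \<open>f\<close>, while their weights produce an unwanted entry 0, which \<open>b\<close>
    corrects. For \<open>M = 0\<close> the sum is empty and \<open>b = 0\<close>.\<close>
  define h where "h = (\<Sum>n\<in>{..<M - 1}. seq_scale (f (Suc n)) (skew_vec p n :: nat \<Rightarrow> 'k))"
  define b where "b = (if M = 0 then 0 else f 0) - h 0"
  define r where "r = (\<lambda>i. if i < M then 0 else f i)"
  have r: "r \<in> lp p"
  proof -
    have "f - r \<in> lp p" by (rule lp_norm_finite_support(1)[of "{..<M}"]) (auto simp: r_def)
    from lp_diff[OF p1 f this] show ?thesis by simp
  qed
  have eq: "f = r + (h + seq_scale b (unit_vec 0))"
    unfolding h_def b_def r_def sum_skew_vec[OF finite_lessThan]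
    by (auto simp: fun_eq_iff seq_scale_def unit_vec_def split: nat.split)
  have "\<forall>\<^sub>F N in sequentially.
      lp_norm p (skew_approx p N - unit_vec 0 :: nat \<Rightarrow> 'k) < e / (2 * (norm b + 1))"
    using skew_approx_tendsto[OF p] e by (intro order_tendstoD) (auto simp: add_nonneg_pos)
  \<comment> \<open>Multiplied by \<open>norm b\<close> this leaves less than \<open>e / 2\<close>;
    the \<open>+ 1\<close> covers \<open>b = 0\<close>.\<close>
  then obtain N where N: "lp_norm p (skew_approx p N - unit_vec 0 :: nat \<Rightarrow> 'k) < e / (2 * (norm b + 1))"
    by (auto simp: eventually_sequentially)
  let ?w = "skew_approx p N - unit_vec 0 :: nat \<Rightarrow> 'k"
  let ?g = "h + seq_scale b (skew_approx p N)"
  have "h \<in> span (range (skew_vec p))" "skew_approx p N \<in> span (range (skew_vec p :: _ \<Rightarrow> _ \<Rightarrow> 'k))"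
    unfolding h_def skew_approx_def by (intro span_sum span_scale span_base rangeI)+
  then have g: "?g \<in> span (range (skew_vec p))" by (intro span_add span_scale)
  have "f - ?g = r + seq_scale (- b) ?w"
    by (subst eq) (simp add: fun_eq_iff seq_scale_def algebra_simps)
  then have "lp_norm p (f - ?g) \<le> lp_norm p r + lp_norm p (seq_scale (- b) ?w)"
    using lp_triangle(2)[OF p1 r lp_scale(1)[OF p1 skew_approx_lp[OF p1]]] by metis
  also have "\<dots> = lp_norm p r + norm b * lp_norm p ?w"
    by (simp only: lp_scale(2)[OF p1 skew_approx_lp[OF p1]] norm_minus_cancel)
  also have "\<dots> < e"
  proof -
    have d: "0 < 2 * (norm b + 1)" by (simp add: add_nonneg_pos)
    have "norm b * lp_norm p ?w \<le> (norm b + 1) * lp_norm p ?w"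
      by (intro mult_right_mono lp_norm_nonneg) simp
    also have "\<dots> < e / 2"
      using N unfolding pos_less_divide_eq[OF d] by (simp add: algebra_simps)
    finally show ?thesis using M by (simp add: r_def)
  qed
  finally show ?thesis using g by blast
qed

section \<open>The basis and its properties\<close>

text \<open>The scalar field is generic so that one argument serves the real and the complex
  case.\<close>

proposition skew_basis:
  fixes p :: real and x :: "nat \<Rightarrow> nat \<Rightarrow> 'k::{real_normed_field, banach}"
  assumes p: "1 < p"
  defines "x \<equiv> skew_vec p"
  shows "banach_space_on.basis seq_scale (lp p) (lp_norm p) x \<and>
         banach_space_on.bidemocratic seq_scale (lp p) (lp_norm p) x \<and>
         \<not> banach_space_on.total_basis seq_scale (lp p) (lp_norm p) x \<and>
         \<not> banach_space_on.quasi_greedy seq_scale (lp p) (lp_norm p) x"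
proof -
  have p1: "1 \<le> p" using p by simp
  interpret B: banach_space_on "seq_scale :: 'k \<Rightarrow> _" "lp p" "lp_norm p"
    by (rule banach_space_on_lp[OF p1])
  have x_lp: "x n \<in> lp p" for n unfolding x_def by (rule skew_vec_lp[OF p1])
  \<comment> \<open>Singletons give the uniform bound 1 on the coordinate functionals, general
    \<open>A\<close> the estimate of \<open>phi_dual\<close>.\<close>
  have dual_sum: "B.dual_nrm (\<lambda>f. \<Sum>n\<in>A. shift_coord p n f) \<le> real (card A) powr (1 - 1 / p)"
    if "finite A" for A
    unfolding B.dual_nrm_def
  proof (rule cSUP_least)
    show "{f \<in> lp p. lp_norm p f \<le> 1} \<noteq> ({} :: (nat \<Rightarrow> 'k) set)"
      using unit_vec_lp p1 by (metis (mono_tags, lifting) empty_iff mem_Collect_eq order_refl)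
    fix f :: "nat \<Rightarrow> 'k" assume "f \<in> {f \<in> lp p. lp_norm p f \<le> 1}"
    then have "real (card A) powr (1 - 1 / p) * lp_norm p f \<le> real (card A) powr (1 - 1 / p) * 1"
      "f \<in> lp p"
      by (auto intro: mult_left_le)
    with norm_sum_shift_coord_le[OF p1 that]
    show "norm (\<Sum>n\<in>A. shift_coord p n f) \<le> real (card A) powr (1 - 1 / p)" by force
  qed
  have coord_f: "B.coord_functionals x (shift_coord p)"
    unfolding B.coord_functionals_def
  proof (intro conjI allI)
    fix n
    have "norm (shift_coord p n f) \<le> 1 * lp_norm p f" if "f \<in> lp p" for f :: "nat \<Rightarrow> 'k"
      using norm_le_lp_norm[OF p1 that] that by (simp add: shift_coord_def)
    then have "\<exists>C. \<forall>f\<in>lp p :: (nat \<Rightarrow> 'k) set. norm (shift_coord p n f) \<le> C * lp_norm p f"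
      by (intro exI[of _ 1]) blast
    moreover have "shift_coord p n (seq_scale c f) = c * shift_coord p n f" if "f \<in> lp p"
      for c and f :: "nat \<Rightarrow> 'k"
      using that lp_scale(1)[OF p1 that] by (simp add: shift_coord_def seq_scale_def)
    ultimately show "shift_coord p n \<in> B.dual"
      unfolding B.dual_def using p1 by (auto simp: shift_coord_def lp_triangle)
  next
    show "\<exists>C. \<forall>n. B.dual_nrm (shift_coord p n) \<le> C"
      using dual_sum[of "{_}"] by auto
  next
    fix n k show "shift_coord p n (x k) = (if n = k then 1 else 0)"
      using x_lp[of k] by (simp add: shift_coord_def x_def skew_vec_def unit_vec_def seq_scale_def)
  qed
  have basis: "B.basis x"
    unfolding B.basis_def
  proof (intro conjI)
    show "\<exists>C. \<forall>n. lp_norm p (x n) \<le> C"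
      using norm_sum_skew_vec_le[OF p1, of "{_}"] unfolding x_def by auto
    show "B.closed_span (range x) = lp p"
      unfolding B.closed_span_def x_def using skew_vec_span_dense[OF p] by blast
  qed (use x_lp coord_f in auto)
  have coord: "B.coord x = shift_coord p"
    by (rule B.coord_eqI[OF basis coord_f])
  have "B.bidemocratic x"
    unfolding B.bidemocratic_def
  proof (intro exI allI)
    fix m :: nat
    let ?F = "{A :: nat set. finite A \<and> card A \<le> m}"
    have ne: "?F \<noteq> {}" by (auto intro: exI[of _ "{}"])
    have "lp_norm p (\<Sum>k\<in>A. x k) \<le> (p + 1) * real m powr (1 / p)" if "A \<in> ?F" for A
    proof -
      have "lp_norm p (\<Sum>k\<in>A. x k) \<le> (p + 1) * real (card A) powr (1 / p)"
        unfolding x_def using that by (intro norm_sum_skew_vec_le p1) auto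
      also have "\<dots> \<le> (p + 1) * real m powr (1 / p)"
        using that p by (intro mult_left_mono powr_mono2) auto
      finally show ?thesis .
    qed
    then have phi: "B.phi x m \<le> (p + 1) * real m powr (1 / p)"
      unfolding B.phi_def by (rule cSUP_least[OF ne])
    have bound: "B.dual_nrm (\<lambda>f. \<Sum>k\<in>A. shift_coord p k f) \<le> real m powr (1 - 1 / p)" if "A \<in> ?F" for A
    proof -
      have "real (card A) powr (1 - 1 / p) \<le> real m powr (1 - 1 / p)"
        using that p by (intro powr_mono2) auto
      then show ?thesis using dual_sum[of A] that by force
    qed
    then have phi_dual: "B.phi_dual x m \<le> real m powr (1 - 1 / p)"
      unfolding B.phi_dual_def coord by (rule cSUP_least[OF ne])
    \<comment> \<open>Multiplying the two upper bounds requires \<open>phi_dual\<close> to be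
      nonnegative; the empty set supplies the value 0 below the supremum.\<close>
    have "B.dual_nrm (\<lambda>f. \<Sum>k\<in>{}. shift_coord p k f) \<le> B.phi_dual x m"
      unfolding B.phi_dual_def coord
      using bound by (intro cSUP_upper bdd_aboveI2[of _ _ "real m powr (1 - 1 / p)"]) auto
    moreover have "B.dual_nrm (\<lambda>f. 0) = 0"
      unfolding B.dual_nrm_def using lp_zero[of p, where 'a = 'k]
      by (subst cSUP_const) (auto simp: lp_norm_def intro!: exI[of _ 0])
    ultimately have "0 \<le> B.phi_dual x m" by simp
    with phi phi_dual have "B.phi x m * B.phi_dual x m
        \<le> (p + 1) * real m powr (1 / p) * real m powr (1 - 1 / p)"
      using p by (intro mult_mono) auto
    \<comment> \<open>The conjugate exponents \<open>1 / p\<close> and \<open>1 - 1 / p\<close> add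
      to 1.\<close>
    also have "\<dots> = (p + 1) * real m"
      by (simp add: mult.assoc powr_add[symmetric])
    finally show "B.phi x m * B.phi_dual x m \<le> (p + 1) * real m" .
  qed
  moreover have "\<not> B.total_basis x"
  proof
    assume "B.total_basis x"
    moreover have "B.coord x n (unit_vec 0) = B.coord x n 0" for n
      by (simp add: coord shift_coord_def unit_vec_def)
    ultimately have "unit_vec 0 = (0 :: nat \<Rightarrow> 'k)"
      unfolding B.total_basis_def inj_on_def using unit_vec_lp(1) lp_zero by blast
    then have "unit_vec 0 0 = (0 :: 'k)" by simp
    then show False by (simp add: unit_vec_def)
  qed
  moreover have "\<not> B.quasi_greedy x"
  proof
    \<comment> \<open>\<open>x\<close>-coordinates cannot see \<open>unit_vec 0\<close>, so \<open>skew_approx p N\<close> is a greedy sum of the null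
      sequence \<open>skew_approx p N - unit_vec 0\<close>.\<close>
    assume "B.quasi_greedy x"
    then obtain C where C: "\<And>f A. f \<in> lp p \<Longrightarrow> B.greedy_set x f A \<Longrightarrow>
        lp_norm p (\<Sum>n\<in>A. seq_scale (B.coord x n f) (x n)) \<le> C * lp_norm p f"
      unfolding B.quasi_greedy_def by blast
    have "1 \<le> C * lp_norm p (skew_approx p N - unit_vec 0 :: nat \<Rightarrow> 'k)" if N: "0 < N" for N
    proof -
      let ?w = "skew_approx p N - unit_vec 0 :: nat \<Rightarrow> 'k"
      have w: "?w \<in> lp p" by (rule skew_approx_lp[OF p1])
      have c: "B.coord x n ?w = (if n < N then of_real (real (Suc n) powr (- 1 / p) / harm N) else 0)" for n
        using w by (simp add: coord shift_coord_def skew_approx_eq[OF N])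
      \<comment> \<open>All coordinates of \<open>?w\<close> outside \<open>{..<N}\<close> vanish,
        so the set is greedy.\<close>
      have "B.greedy_set x ?w {..<N}"
        unfolding B.greedy_set_def c by auto
      note C[OF w this]
      also have "(\<Sum>n<N. seq_scale (B.coord x n ?w) (x n)) =
          (\<Sum>n<N. seq_scale (of_real (real (Suc n) powr (- 1 / p) / harm N)) (x n))"
        by (rule sum.cong) (simp_all only: c lessThan_iff if_True)
      also have "\<dots> = skew_approx p N" by (simp only: skew_approx_def x_def)
      finally have "lp_norm p (skew_approx p N :: nat \<Rightarrow> 'k) \<le> C * lp_norm p ?w" .
      moreover have "skew_approx p N \<in> (lp p :: (nat \<Rightarrow> 'k) set)"
        unfolding skew_approx_def x_def[symmetric]
        by (intro B.subspace_sum B.subspace_scale B.subspace_V x_lp)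
      \<comment> \<open>Entry 0 of \<open>skew_approx p N\<close> is 1, which keeps its norm at
        least 1 while that of \<open>?w\<close> tends to 0.\<close>
      from norm_le_lp_norm[OF p1 this, of 0]
      have "norm ((skew_approx p N :: nat \<Rightarrow> 'k) 0) \<le> lp_norm p (skew_approx p N :: nat \<Rightarrow> 'k)" .
      moreover have "(skew_approx p N :: nat \<Rightarrow> 'k) 0 = 1"
        using fun_cong[OF skew_approx_eq[OF N, of p], of 0] by (simp add: unit_vec_def)
      ultimately show ?thesis by simp
    qed
    moreover have "(\<lambda>N. C * lp_norm p (skew_approx p N - unit_vec 0 :: nat \<Rightarrow> 'k)) \<longlonglongrightarrow> C * 0"
      by (intro tendsto_intros skew_approx_tendsto[OF p])
    ultimately have "1 \<le> C * 0"
      by (intro tendsto_lowerbound[of _ _ sequentially])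
        (auto intro: eventually_mono[OF eventually_gt_at_top[of 0]])
    then show False by simp
  qed
  ultimately show ?thesis using basis by blast
qed

theorem theorem3p8:
  fixes p :: real
  assumes "1 < p"
  shows "(\<exists>x :: nat \<Rightarrow> nat \<Rightarrow> real.
            banach_space_on.basis seq_scale (lp p) (lp_norm p) x \<and>
            banach_space_on.bidemocratic seq_scale (lp p) (lp_norm p) x \<and>
            \<not> banach_space_on.total_basis seq_scale (lp p) (lp_norm p) x \<and>
            \<not> banach_space_on.quasi_greedy seq_scale (lp p) (lp_norm p) x) \<and>
         (\<exists>x :: nat \<Rightarrow> nat \<Rightarrow> complex.
            banach_space_on.basis seq_scale (lp p) (lp_norm p) x \<and>
            banach_space_on.bidemocratic seq_scale (lp p) (lp_norm p) x \<and>
            \<not> banach_space_on.total_basis seq_scale (lp p) (lp_norm p) x \<and>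
            \<not> banach_space_on.quasi_greedy seq_scale (lp p) (lp_norm p) x)"
  using skew_basis[OF assms, where 'k = real] skew_basis[OF assms, where 'k = complex] by blast

end
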